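(* Let $(X_1,Y_1),(X_2,Y_2),\ldots$ be independent and identically distributed random vectors with bivariate distribution function $H$ having continuous marginal distribution functions $F$ and $G$ and copula $C$. Let $p_0\in(0,1)$ be fixed, let $\mathcal{P}=[p_0,1]$, and let $m=m(n)$ be a sequence of positive integers with $m(n)\to\infty$ as $n\to\infty$. Then, as $n\to\infty$, \[ \sup_{p\in\mathcal{P}}|\widehat{\rho}_{m,n}(p)-\rho(p)|\to 0\qquad\text{almost surely}, \] where $\rho$ is the lower-tail Spearman's rho curve of $C$ and $\widehat{\rho}_{m,n}$ is its Bernstein-smoothed estimator. In particular, $\widehat{\rho}_{m,n}(p)\to\rho(p)$ almost surely for every fixed $p\in(0,1]$.
   Context: By Sklar's theorem, $C$ is the unique copula with $H(x,y)=C\{F(x),G(y)\}$. For $p\in(0,1]$, set $D(p)=p^3/3-p^4/4$ (which is $>0$). The lower-tail Spearman's rho curve of $C$ is \[ \rho(p)=\frac{\int_{[0,p]^2}C(u,v)\,\mathrm{d}u\,\mathrm{d}v-p^4/4}{D(p)},\qquad p\in(0,1]. \] Let $F_n(x)=n^{-1}\sum_{i=1}^n\mathbf{1}\{X_i\le x\}$ and $G_n(y)=n^{-1}\sum_{i=1}^n\mathbf{1}\{Y_i\le y\}$ be the empirical marginal distribution functions. The empirical copula is \[ C_n(u,v)=\frac1n\sum_{i=1}^n\mathbf{1}\{F_n(X_i)\le u,\;G_n(Y_i)\le v\},\qquad(u,v)\in[0,1]^2. \] For an integer $m\ge1$ and $k=0,\ldots,m$, let $P_{k,m}(u)=\binom{m}{k}u^k(1-u)^{m-k}$,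 and for a bounded function $h$ on $[0,1]^2$ let \[ B_m(h)(u,v)=\sum_{k=0}^m\sum_{\ell=0}^m h(k/m,\ell/m)P_{k,m}(u)P_{\ell,m}(v). \] The empirical Bernstein copula is $C_{m,n}=B_m(C_n)$, and the Bernstein-smoothed estimator is \[ \widehat{\rho}_{m,n}(p)=\frac{\int_{[0,p]^2}C_{m,n}(u,v)\,\mathrm{d}u\,\mathrm{d}v-p^4/4}{D(p)},\qquad p\in(0,1]. \] *)

theory Defs
  imports "HOL-Probability.Probability"
begin

definition joint_cdf :: "(real \<times> real) measure \<Rightarrow> real \<Rightarrow> real \<Rightarrow> real" where
  "joint_cdf N x y = measure N ({..x} \<times> {..y})"

text \<open>Copulas are functions on the unit square. Only the values there are constrained; nothing
  below evaluates a copula elsewhere. The last conjunct says that rectangles have nonnegative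
  volume.\<close>

definition copula :: "(real \<Rightarrow> real \<Rightarrow> real) \<Rightarrow> bool" where
  "copula C \<longleftrightarrow>
     (\<forall>u\<in>{0..1}. C u 0 = 0 \<and> C 0 u = 0) \<and>
     (\<forall>u\<in>{0..1}. C u 1 = u \<and> C 1 u = u) \<and>
     (\<forall>u\<^sub>1 u\<^sub>2 v\<^sub>1 v\<^sub>2. 0 \<le> u\<^sub>1 \<longrightarrow> u\<^sub>1 \<le> u\<^sub>2 \<longrightarrow> u\<^sub>2 \<le> 1 \<longrightarrow> 0 \<le> v\<^sub>1 \<longrightarrow> v\<^sub>1 \<le> v\<^sub>2 \<longrightarrow> v\<^sub>2 \<le> 1 \<longrightarrow>
        C u\<^sub>2 v\<^sub>2 - C u\<^sub>2 v\<^sub>1 - C u\<^sub>1 v\<^sub>2 + C u\<^sub>1 v\<^sub>1 \<ge> 0)"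

definition rho_denom :: "real \<Rightarrow> real" where
  "rho_denom p = p ^ 3 / 3 - p ^ 4 / 4"

definition lower_tail_rho :: "(real \<Rightarrow> real \<Rightarrow> real) \<Rightarrow> real \<Rightarrow> real" where
  "lower_tail_rho C p =
     ((LINT w:({0..p} \<times> {0..p})|lborel. C (fst w) (snd w)) - p ^ 4 / 4) / rho_denom p"

text \<open>A sample of size \<open>n\<close> is given by the values \<open>x 1, \<dots>, x n\<close> of a sequence;
  the entry \<open>x 0\<close> is never used.\<close>

definition emp_cdf :: "nat \<Rightarrow> (nat \<Rightarrow> real) \<Rightarrow> real \<Rightarrow> real" where
  "emp_cdf n x t = (\<Sum>i=1..n. of_bool (x i \<le> t)) / real n"

definition emp_copula :: "nat \<Rightarrow> (nat \<Rightarrow> real) \<Rightarrow> (nat \<Rightarrow> real) \<Rightarrow> real \<Rightarrow> real \<Rightarrow> real" where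
  "emp_copula n x y u v =
     (\<Sum>i=1..n. of_bool (emp_cdf n x (x i) \<le> u \<and> emp_cdf n y (y i) \<le> v)) / real n"

definition bernstein_op :: "nat \<Rightarrow> (real \<Rightarrow> real \<Rightarrow> real) \<Rightarrow> real \<Rightarrow> real \<Rightarrow> real" where
  "bernstein_op m h u v =
     (\<Sum>k=0..m. \<Sum>l=0..m. h (real k / real m) (real l / real m) * Bernstein m k u * Bernstein m l v)"

definition emp_bernstein_copula ::
  "nat \<Rightarrow> nat \<Rightarrow> (nat \<Rightarrow> real) \<Rightarrow> (nat \<Rightarrow> real) \<Rightarrow> real \<Rightarrow> real \<Rightarrow> real" where
  "emp_bernstein_copula m n x y = bernstein_op m (emp_copula n x y)"

definition rho_hat :: "nat \<Rightarrow> nat \<Rightarrow> (nat \<Rightarrow> real) \<Rightarrow> (nat \<Rightarrow> real) \<Rightarrow> real \<Rightarrow> real" where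
  "rho_hat m n x y p =
     ((LINT w:({0..p} \<times> {0..p})|lborel. emp_bernstein_copula m n x y (fst w) (snd w)) - p ^ 4 / 4)
       / rho_denom p"

end

theory Submission
  imports Defs "HOL-Real_Asymp.Real_Asymp"
begin

text \<open>By continuity of the marginals, every level in the open unit interval has a marginal quantile.
  Hoeffding's inequality and the Borel--Cantelli lemma give, almost surely, convergence of the
  empirical measure on the countably many quadrants cut off at quantiles of rational level, where
  the limit is the value of \<open>C\<close> by Sklar's formula. As the empirical copula is monotone and \<open>C\<close> is
  Lipschitz, sandwiching on a finite grid upgrades this to uniform convergence on the unit square.
  Bernstein averaging of \<open>C\<close> costs at most \<open>2 / sqrt m\<close>, and an error \<open>e\<close> in the copula becomes an
  error of at most \<open>12 e / p\<close> in the curve because the denominator is at least \<open>p\<^sup>3 / 12\<close>.\<close>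


section \<open>Lipschitz continuity of copulas\<close>

text \<open>Nonnegative volume of \<open>[u, u'] x [0, v]\<close> gives monotonicity, and that of
  \<open>[u, u'] x [v, 1]\<close> the Lipschitz bound, once the boundary values are
  inserted.\<close>

lemma copula_mono_lipschitz_left:
  assumes "copula C" "0 \<le> u" "u \<le> u'" "u' \<le> 1" "0 \<le> v" "v \<le> 1"
  shows "C u v \<le> C u' v" and "C u' v - C u v \<le> u' - u"
proof -
  have *: "C u' b - C u' a - C u b + C u a \<ge> 0" if "0 \<le> a" "a \<le> b" "b \<le> 1" for a b
    using assms that unfolding copula_def by blast
  have "C u 0 = 0" "C u' 0 = 0" "C u 1 = u" "C u' 1 = u'"
    using assms unfolding copula_def by auto
  then show "C u v \<le> C u' v" "C u' v - C u v \<le> u' - u"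
    using *[of 0 v] *[of v 1] assms by auto
qed

lemma copula_flip: "copula C \<Longrightarrow> copula (\<lambda>u v. C v u)"
  unfolding copula_def by (smt (verit))

lemma copula_lipschitz:
  assumes "copula C" "u \<in> {0..1}" "u' \<in> {0..1}" "v \<in> {0..1}" "v' \<in> {0..1}"
  shows "\<bar>C u v - C u' v'\<bar> \<le> \<bar>u - u'\<bar> + \<bar>v - v'\<bar>"
proof -
  have 1: "\<bar>D a c - D b c\<bar> \<le> \<bar>a - b\<bar>"
    if "copula D" "a \<in> {0..1}" "b \<in> {0..1}" "c \<in> {0..1}" for D a b c
    using copula_mono_lipschitz_left[OF that(1), of a b c]
      copula_mono_lipschitz_left[OF that(1), of b a c] that
    by (cases "a \<le> b") auto
  have "\<bar>C u v - C u' v\<bar> \<le> \<bar>u - u'\<bar>"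
    using 1[OF assms(1)] assms by auto
  moreover have "\<bar>C u' v - C u' v'\<bar> \<le> \<bar>v - v'\<bar>"
    using 1[OF copula_flip[OF assms(1)]] assms by auto
  ultimately show ?thesis by linarith
qed

text \<open>Supplies integrability of \<open>C\<close> over the squares in the definition of the
  curve.\<close>

lemma copula_continuous_on:
  assumes "copula C"
  shows "continuous_on ({0..1} \<times> {0..1}) (\<lambda>w. C (fst w) (snd w))"
proof -
  have "2-lipschitz_on ({0..1} \<times> {0..1}) (\<lambda>w. C (fst w) (snd w))"
  proof (rule lipschitz_onI)
    fix w z :: "real \<times> real"
    assume "w \<in> {0..1} \<times> {0..1}" "z \<in> {0..1} \<times> {0..1}"
    then have "\<bar>C (fst w) (snd w) - C (fst z) (snd z)\<bar> \<le> \<bar>fst w - fst z\<bar> + \<bar>snd w - snd z\<bar>"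
      by (intro copula_lipschitz[OF assms]) auto
    then show "dist (C (fst w) (snd w)) (C (fst z) (snd z)) \<le> 2 * dist w z"
      using dist_fst_le[of w z] dist_snd_le[of w z] by (simp add: dist_real_def)
  qed auto
  then show ?thesis
    by (rule lipschitz_on_continuous_on)
qed

section \<open>Uniform convergence of the empirical copula\<close>

lemma emp_cdf_mono: "s \<le> t \<Longrightarrow> emp_cdf n x s \<le> emp_cdf n x t"
  unfolding emp_cdf_def by (intro divide_right_mono sum_mono) (auto simp: of_bool_def)

lemma emp_cdf_le_1: "emp_cdf n x t \<le> 1"
proof -
  have "(\<Sum>i=1..n. of_bool (x i \<le> t)) \<le> (\<Sum>i=1..n. 1::real)"
    by (rule sum_mono) (simp add: of_bool_def)
  then show ?thesis by (simp add: emp_cdf_def divide_le_eq)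
qed

definition emp_measure :: "nat \<Rightarrow> (nat \<Rightarrow> 'b) \<Rightarrow> 'b set \<Rightarrow> real" where
  "emp_measure n z S = (\<Sum>i=1..n. indicator S (z i)) / real n"

text \<open>The family \<open>a\<close> stands for quantiles, which exist only at levels strictly between 0 and 1;
  extending the half-lines by \<open>{}\<close> and \<open>UNIV\<close> spares the boundary of the square a separate
  treatment.\<close>

definition level :: "(real \<Rightarrow> real) \<Rightarrow> real \<Rightarrow> real set" where
  "level a q = (if q \<le> 0 then {} else if q \<ge> 1 then UNIV else {..a q})"

text \<open>Grid levels may leave the unit interval. Moving them to its nearest point matches
  \<open>level\<close>: the empty set corresponds to 0, the whole line to 1.\<close>

definition clamp01 :: "real \<Rightarrow> real" where
  "clamp01 q = max 0 (min 1 q)"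

text \<open>Lower half of the sandwich: at an interior level, \<open>t \<le> a q\<close> forces
  \<open>emp_cdf n x t \<le> emp_cdf n x (a q) < q + d\<close>. The set is empty for
  \<open>q \<le> 0\<close>; for \<open>q \<ge> 1\<close> the bound 1 on \<open>emp_cdf\<close>
  suffices.\<close>

lemma emp_cdf_le_if_in_level:
  assumes "\<bar>emp_cdf n x (a q) - q\<bar> < d \<or> q \<le> 0 \<or> q \<ge> 1" "q + d \<le> u" "d > 0" "t \<in> level a q"
  shows "emp_cdf n x t \<le> u"
  using assms emp_cdf_mono[of t "a q" n x] emp_cdf_le_1[of n x t]
  by (auto simp: level_def split: if_splits)

text \<open>Upper half, by contraposition: beyond an interior quantile \<open>emp_cdf\<close>
  exceeds \<open>q - d\<close>, hence \<open>u\<close>. Levels \<open>q \<le> 0\<close> cannot occur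
  because \<open>u + d > 0\<close>.\<close>

lemma in_level_if_emp_cdf_le:
  assumes "\<bar>emp_cdf n x (a q) - q\<bar> < d \<or> q \<le> 0 \<or> q \<ge> 1" "u + d \<le> q" "d > 0" "u \<ge> 0"
    "emp_cdf n x t \<le> u"
  shows "t \<in> level a q"
proof (rule ccontr)
  assume "t \<notin> level a q"
  then show False
    using assms emp_cdf_mono[of "a q" t n x] by (auto simp: level_def split: if_splits)
qed

text \<open>Stated for a single pair of sequences, so that probability enters only through
  convergence on rational quadrants.\<close>

lemma emp_copula_uniform_convergence:
  assumes C: "copula C"
    and conv: "\<And>q r. q \<in> \<rat> \<Longrightarrow> r \<in> \<rat> \<Longrightarrow>
       (\<lambda>n. emp_measure n (\<lambda>i. (x i, y i)) (level a q \<times> level b r)) \<longlonglongrightarrow> C (clamp01 q) (clamp01 r)"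
    and "e > 0"
  shows "\<forall>\<^sub>F n in sequentially. \<forall>u\<in>{0..1}. \<forall>v\<in>{0..1}. \<bar>emp_copula n x y u v - C u v\<bar> \<le> e"
proof -
  \<comment> \<open>The total error will be \<open>5 * d\<close>: one \<open>d\<close> from the
    empirical measure of a quadrant and \<open>2 * d\<close> per coordinate from the Lipschitz
    bound.\<close>
  obtain N :: nat where N: "N > 0" "5 / e < real N"
    using reals_Archimedean2[of "max 1 (5 / e)"]
    by (metis less_numeral_extra(1) max_less_iff_conj of_nat_less_iff of_nat_1 less_trans)
  define d where "d = 1 / real N"
  have d: "d > 0" "5 * d \<le> e"
    using N \<open>e > 0\<close> by (auto simp: d_def field_simps)
  \<comment> \<open>The indices overshoot because a point with floor index \<open>j\<close> in
    \<open>0..N\<close> is bracketed by \<open>j - 1\<close> and \<open>j + 2\<close>.\<close>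
  define Q where "Q = (\<lambda>j::int. of_int j / real N) ` {-1..int N + 2}"
  let ?E = "\<lambda>n q r. emp_measure n (\<lambda>i. (x i, y i)) (level a q \<times> level b r)"
  have Q: "finite Q" "Q \<subseteq> \<rat>" "1 \<in> Q"
  proof -
    show "1 \<in> Q"
      unfolding Q_def by (rule image_eqI[of _ _ "int N"]) (use N in auto)
  qed (auto simp: Q_def)
  have "\<forall>q\<in>Q. \<forall>r\<in>Q. \<forall>\<^sub>F n in sequentially. \<bar>?E n q r - C (clamp01 q) (clamp01 r)\<bar> < d"
    using conv Q d tendstoD[OF conv, of _ _ d] by (auto simp: dist_real_def subset_iff)
  then have "\<forall>\<^sub>F n in sequentially. \<forall>q\<in>Q. \<forall>r\<in>Q. \<bar>?E n q r - C (clamp01 q) (clamp01 r)\<bar> < d"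
    using Q by (simp add: eventually_ball_finite_distrib)
  then show ?thesis
  proof (rule eventually_mono)
    fix n
    assume E: "\<forall>q\<in>Q. \<forall>r\<in>Q. \<bar>?E n q r - C (clamp01 q) (clamp01 r)\<bar> < d"
    \<comment> \<open>A quadrant with second level 1 is a half-plane: its empirical measure is the
      marginal \<open>emp_cdf\<close>, and its limit is \<open>q\<close> by the boundary values of
      \<open>C\<close>.\<close>
    have Fx: "\<bar>emp_cdf n x (a q) - q\<bar> < d \<or> q \<le> 0 \<or> q \<ge> 1" if "q \<in> Q" for q
    proof (cases "q \<le> 0 \<or> q \<ge> 1")
      case False
      then have "?E n q 1 = emp_cdf n x (a q)" "C (clamp01 q) (clamp01 1) = q"
        using C by (auto simp: emp_measure_def emp_cdf_def level_def clamp01_def copula_def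
          indicator_def of_bool_def)
      then show ?thesis
        using E that Q by metis
    qed auto
    have Fy: "\<bar>emp_cdf n y (b q) - q\<bar> < d \<or> q \<le> 0 \<or> q \<ge> 1" if "q \<in> Q" for q
    proof (cases "q \<le> 0 \<or> q \<ge> 1")
      case False
      then have "?E n 1 q = emp_cdf n y (b q)" "C (clamp01 1) (clamp01 q) = q"
        using C by (auto simp: emp_measure_def emp_cdf_def level_def clamp01_def copula_def
          indicator_def of_bool_def)
      then show ?thesis
        using E that Q by metis
    qed auto
    have grid: "\<exists>q\<in>Q. \<exists>q'\<in>Q. q + d \<le> u \<and> u - q \<le> 2 * d \<and> u + d \<le> q' \<and> q' - u \<le> 2 * d"
      if u: "u \<in> {0..1}" for u
    proof -
      \<comment> \<open>Going one grid point beyond \<open>j\<close> and \<open>j + 1\<close> leaves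
        a gap of at least \<open>d\<close> on both sides of \<open>u\<close>, which absorbs the
        error of the marginal \<open>emp_cdf\<close>.\<close>
      define j where "j = \<lfloor>u * N\<rfloor>"
      have j: "of_int j \<le> u * N" "u * N < of_int j + 1"
        unfolding j_def by linarith+
      have "0 \<le> j" "j \<le> int N"
        using u mult_right_mono[of u 1 "real N"] unfolding j_def by (auto simp: floor_le_iff)
      then have "of_int (j - 1) / real N \<in> Q" "of_int (j + 2) / real N \<in> Q"
        unfolding Q_def by (intro imageI; auto)+
      moreover have "of_int (j - 1) / real N + d \<le> u" "u - of_int (j - 1) / real N \<le> 2 * d"
        "u + d \<le> of_int (j + 2) / real N" "of_int (j + 2) / real N - u \<le> 2 * d"
      proof -
        have "of_int j / real N \<le> u" "u \<le> of_int j / real N + d"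
          using j N by (auto simp: d_def field_simps)
        moreover have "of_int (j - 1) / real N = of_int j / real N - d"
          "of_int (j + 2) / real N = of_int j / real N + 2 * d"
          by (auto simp: d_def add_divide_distrib diff_divide_distrib)
        ultimately show "of_int (j - 1) / real N + d \<le> u" "u - of_int (j - 1) / real N \<le> 2 * d"
          "u + d \<le> of_int (j + 2) / real N" "of_int (j + 2) / real N - u \<le> 2 * d"
          by linarith+
      qed
      ultimately show ?thesis by blast
    qed
    have clamp: "\<bar>clamp01 q - u\<bar> \<le> \<bar>q - u\<bar>" "clamp01 q \<in> {0..1}" if "u \<in> {0..1}" for q u
      using that by (auto simp: clamp01_def)
    show "\<forall>u\<in>{0..1}. \<forall>v\<in>{0..1}. \<bar>emp_copula n x y u v - C u v\<bar> \<le> e"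
    proof (intro ballI)
      fix u v :: real
      assume u: "u \<in> {0..1}" and v: "v \<in> {0..1}"
      obtain q q' where q: "q \<in> Q" "q' \<in> Q" "q + d \<le> u" "u - q \<le> 2 * d" "u + d \<le> q'" "q' - u \<le> 2 * d"
        using grid[OF u] by blast
      obtain r r' where r: "r \<in> Q" "r' \<in> Q" "r + d \<le> v" "v - r \<le> 2 * d" "v + d \<le> r'" "r' - v \<le> 2 * d"
        using grid[OF v] by blast
      \<comment> \<open>Every sample point in the smaller quadrant is counted by the empirical
        copula, and every point it counts lies in the larger one.\<close>
      have "?E n q r \<le> emp_copula n x y u v"
        unfolding emp_copula_def emp_measure_def
        using emp_cdf_le_if_in_level[where a=a, OF Fx[OF q(1)] q(3) d(1)]
          emp_cdf_le_if_in_level[where a=b, OF Fy[OF r(1)] r(3) d(1)]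
        by (intro divide_right_mono sum_mono) (auto simp: indicator_def)
      moreover have "emp_copula n x y u v \<le> ?E n q' r'"
        unfolding emp_copula_def emp_measure_def
        using in_level_if_emp_cdf_le[where a=a, OF Fx[OF q(2)] q(5) d(1)]
          in_level_if_emp_cdf_le[where a=b, OF Fy[OF r(2)] r(5) d(1)] u v
        by (intro divide_right_mono sum_mono) (auto simp: indicator_def)
      moreover have "\<bar>?E n q r - C (clamp01 q) (clamp01 r)\<bar> < d" "\<bar>?E n q' r' - C (clamp01 q') (clamp01 r')\<bar> < d"
        using E q r by auto
      moreover have "\<bar>C (clamp01 q) (clamp01 r) - C u v\<bar> \<le> 4 * d"
        using copula_lipschitz[OF C clamp(2)[OF u] u clamp(2)[OF v] v, of q r]
          clamp(1)[OF u, of q] clamp(1)[OF v, of r] q r d by linarith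
      moreover have "\<bar>C (clamp01 q') (clamp01 r') - C u v\<bar> \<le> 4 * d"
        using copula_lipschitz[OF C clamp(2)[OF u] u clamp(2)[OF v] v, of q' r']
          clamp(1)[OF u, of q'] clamp(1)[OF v, of r'] q r d by linarith
      ultimately show "\<bar>emp_copula n x y u v - C u v\<bar> \<le> e"
        using d by linarith
    qed
  qed
qed

section \<open>Approximation by Bernstein averages\<close>

text \<open>The sum is the mean absolute deviation of a binomial proportion; its variance
  \<open>u * (1 - u) / m\<close> yields the order \<open>1 / sqrt m\<close>.\<close>

lemma bernstein_mean_deviation:
  assumes "u \<in> {0..1}" "m > 0"
  shows "(\<Sum>k=0..m. \<bar>real k / real m - u\<bar> * Bernstein m k u) \<le> 1 / sqrt m"
proof -
  define s where "s = sqrt m"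
  have s: "s > 0" "real m = s * s"
    using assms by (auto simp: s_def)
  have var: "(\<Sum>k\<le>m. (real k / real m - u)\<^sup>2 * Bernstein m k u) = u * (1 - u) / m"
  proof -
    \<comment> \<open>Writing \<open>k\<^sup>2\<close> as \<open>k * (k - 1) + k\<close> reduces the
      variance to the known factorial moments of the weights.\<close>
    have "(\<Sum>k\<le>m. (real k / real m - u)\<^sup>2 * Bernstein m k u) =
       (\<Sum>k\<le>m. (1 / m\<^sup>2) * (real k * (real k - 1) * Bernstein m k u) + (1/m\<^sup>2 - 2 * u / m) * (real k * Bernstein m k u)
         + u\<^sup>2 * Bernstein m k u)"
      using assms by (intro sum.cong) (auto simp: field_simps power2_eq_square)
    also have "\<dots> = (1 / m\<^sup>2) * (real m * (real m - 1) * u\<^sup>2) + (1/m\<^sup>2 - 2 * u / m) * (real m * u) + u\<^sup>2"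
      by (simp only: sum.distrib sum_distrib_left[symmetric] sum_kk_Bernstein sum_k_Bernstein sum_Bernstein mult_1_right)
    also have "\<dots> = u * (1 - u) / m"
      using assms by (simp add: field_simps power2_eq_square)
    finally show ?thesis .
  qed
  \<comment> \<open>AM-GM: \<open>2\<bar>t\<bar> \<le> 1 / s + s t\<^sup>2\<close>\<close>
  have "(\<Sum>k=0..m. \<bar>real k / real m - u\<bar> * Bernstein m k u) \<le>
     (\<Sum>k\<le>m. (1 / (2 * s)) * Bernstein m k u + (s / 2) * ((real k / real m - u)\<^sup>2 * Bernstein m k u))"
    unfolding atMost_atLeast0
  proof (rule sum_mono)
    fix k
    define t where "t = real k / real m - u"
    have "0 \<le> (s * \<bar>t\<bar> - 1)\<^sup>2 / (2 * s)"
      using s by simp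
    also have "(s * \<bar>t\<bar> - 1)\<^sup>2 / (2 * s) = 1 / (2 * s) + s / 2 * t\<^sup>2 - \<bar>t\<bar>"
      using s by (simp add: power2_diff field_simps power_mult_distrib) (simp add: power2_eq_square)
    finally have "\<bar>t\<bar> * Bernstein m k u \<le> (1 / (2 * s) + s / 2 * t\<^sup>2) * Bernstein m k u"
      using assms by (intro mult_right_mono Bernstein_nonneg) auto
    then show "\<bar>real k / real m - u\<bar> * Bernstein m k u \<le> (1 / (2 * s)) * Bernstein m k u + (s / 2) * ((real k / real m - u)\<^sup>2 * Bernstein m k u)"
      by (simp add: t_def algebra_simps)
  qed
  also have "\<dots> = 1 / (2 * s) + (s / 2) * (u * (1 - u) / m)"
    by (simp only: sum.distrib sum_distrib_left[symmetric] var sum_Bernstein mult_1_right)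
  \<comment> \<open>As \<open>m = s * s\<close>, the crude bound \<open>u * (1 - u) \<le> 1\<close>
    makes the second term equal to the first.\<close>
  also have "\<dots> \<le> 1 / (2 * s) + (s / 2) * (1 / m)"
    using assms s by (intro add_left_mono mult_left_mono divide_right_mono) (auto simp: mult_le_one)
  also have "\<dots> = 1 / s"
    using s by (simp add: field_simps)
  finally show ?thesis by (simp add: s_def)
qed

text \<open>The weights are nonnegative with total mass one, so the error is a weighted mean of
  errors at the nodes. Each of these is at most \<open>e\<close> plus the two coordinate distances,
  whose means are at most \<open>1 / sqrt m\<close>.\<close>

lemma bernstein_op_approx:
  assumes lip: "\<And>u v u' v'. u \<in> {0..1} \<Longrightarrow> u' \<in> {0..1} \<Longrightarrow> v \<in> {0..1} \<Longrightarrow> v' \<in> {0..1} \<Longrightarrow>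
      \<bar>g u v - g u' v'\<bar> \<le> \<bar>u - u'\<bar> + \<bar>v - v'\<bar>"
    and close: "\<And>u v. u \<in> {0..1} \<Longrightarrow> v \<in> {0..1} \<Longrightarrow> \<bar>h u v - g u v\<bar> \<le> e"
    and u: "u \<in> {0..1}" and v: "v \<in> {0..1}" and m: "m > 0"
  shows "\<bar>bernstein_op m h u v - g u v\<bar> \<le> e + 2 / sqrt m"
proof -
  let ?P = "\<lambda>k. Bernstein m k u" and ?R = "\<lambda>l. Bernstein m l v"
  have one: "(\<Sum>k=0..m. ?P k) = 1" "(\<Sum>l=0..m. ?R l) = 1"
    unfolding atLeast0AtMost by simp_all
  have nn: "?P k \<ge> 0" "?R k \<ge> 0" for k
    using u v by (auto intro: Bernstein_nonneg)
  have g: "g u v = (\<Sum>k=0..m. \<Sum>l=0..m. g u v * ?P k * ?R l)"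
    by (simp add: sum_distrib_left[symmetric] sum_distrib_right[symmetric] one)
  have "bernstein_op m h u v - g u v =
     (\<Sum>k=0..m. \<Sum>l=0..m. (h (real k / real m) (real l / real m) - g u v) * ?P k * ?R l)"
    by (simp only: bernstein_op_def left_diff_distrib sum_subtractf g[symmetric])
  then have "\<bar>bernstein_op m h u v - g u v\<bar> \<le>
     (\<Sum>k=0..m. \<Sum>l=0..m. \<bar>(h (real k / real m) (real l / real m) - g u v) * ?P k * ?R l\<bar>)"
    by (auto intro: order.trans[OF sum_abs] sum_mono)
  also have "\<dots> \<le> (\<Sum>k=0..m. \<Sum>l=0..m. (e + \<bar>real k / real m - u\<bar> + \<bar>real l / real m - v\<bar>) * ?P k * ?R l)"
  proof (intro sum_mono)
    fix k l assume "k \<in> {0..m}" "l \<in> {0..m}"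
    then have kl: "real k / real m \<in> {0..1}" "real l / real m \<in> {0..1}"
      using m by auto
    have "\<bar>h (real k / real m) (real l / real m) - g u v\<bar> \<le> e + \<bar>real k / real m - u\<bar> + \<bar>real l / real m - v\<bar>"
      using lip[OF kl(1) u kl(2) v] close[OF kl] by linarith
    then show "\<bar>(h (real k / real m) (real l / real m) - g u v) * ?P k * ?R l\<bar> \<le>
        (e + \<bar>real k / real m - u\<bar> + \<bar>real l / real m - v\<bar>) * ?P k * ?R l"
      using nn by (auto simp: abs_mult intro!: mult_right_mono)
  qed
  also have "\<dots> = (\<Sum>k=0..m. \<Sum>l=0..m. e * ?P k * ?R l)
      + (\<Sum>k=0..m. \<Sum>l=0..m. \<bar>real k / real m - u\<bar> * ?P k * ?R l)
      + (\<Sum>k=0..m. \<Sum>l=0..m. ?P k * (\<bar>real l / real m - v\<bar> * ?R l))"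
    by (simp add: sum.distrib[symmetric] algebra_simps)
  also have "\<dots> = e + (\<Sum>k=0..m. \<bar>real k / real m - u\<bar> * ?P k) + (\<Sum>l=0..m. \<bar>real l / real m - v\<bar> * ?R l)"
    by (simp add: sum_distrib_left[symmetric] sum_distrib_right[symmetric] one)
  also have "\<dots> \<le> e + 2 / sqrt m"
    using bernstein_mean_deviation[OF u m] bernstein_mean_deviation[OF v m] by simp
  finally show ?thesis .
qed

section \<open>From copula errors to errors of the curve\<close>

text \<open>A polynomial in both variables even when \<open>h\<close> is a step function, so the
  smoothed integrand is integrable.\<close>

lemma bernstein_op_continuous_on:
  "continuous_on S (\<lambda>w. bernstein_op m h (fst w) (snd w))"
  unfolding bernstein_op_def Bernstein_def by (intro continuous_intros)

lemma set_integral_square_diff_le: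
  fixes f g :: "real \<times> real \<Rightarrow> real"
  assumes "continuous_on ({0..p} \<times> {0..p}) f" "continuous_on ({0..p} \<times> {0..p}) g" "p \<ge> 0"
    and le: "\<And>w. w \<in> {0..p} \<times> {0..p} \<Longrightarrow> \<bar>f w - g w\<bar> \<le> e"
  shows "\<bar>(LINT w:({0..p} \<times> {0..p})|lborel. f w) - (LINT w:({0..p} \<times> {0..p})|lborel. g w)\<bar> \<le> e * p\<^sup>2"
proof -
  let ?S = "{0..p} \<times> {0..p}"
  have int: "set_integrable lborel ?S h" if "continuous_on ?S h" for h :: "real \<times> real \<Rightarrow> real"
    unfolding set_integrable_def by (intro borel_integrable_compact compact_Times that) auto
  have "(LINT w:?S|lborel. f w) - (LINT w:?S|lborel. g w) = (LINT w:?S|lborel. f w - g w)"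
    using int assms by simp
  also have "\<bar>\<dots>\<bar> \<le> (LINT w:?S|lborel. \<bar>f w - g w\<bar>)"
    using set_integral_norm_bound[OF int, of "\<lambda>w. f w - g w"] assms
    by (auto intro: continuous_on_diff)
  also have "\<dots> \<le> (LINT w:?S|lborel. e)"
    using assms by (intro set_integral_mono int continuous_intros) auto
  also have "\<dots> = e * p\<^sup>2"
  proof -
    have "?S = cbox (0, 0) (p, p)"
      by (simp add: cbox_Pair_eq)
    then have "measure lborel ?S = p\<^sup>2"
      using \<open>p \<ge> 0\<close> by (simp add: content_Pair power2_eq_square)
    then show ?thesis
      by (simp add: set_lebesgue_integral_def)
  qed
  finally show ?thesis .
qed

text \<open>On the unit interval \<open>p ^ 4 \<le> p ^ 3\<close>, and 1/3 - 1/4 = 1/12.\<close>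

lemma rho_denom_ge:
  assumes "0 \<le> p" "p \<le> 1"
  shows "rho_denom p \<ge> p ^ 3 / 12"
proof -
  have "p ^ 3 * p \<le> p ^ 3 * 1"
    using assms by (intro mult_left_mono) auto
  moreover have "p ^ 4 = p ^ 3 * p"
    by (simp add: power_numeral_reduce)
  ultimately show ?thesis unfolding rho_denom_def by linarith
qed

text \<open>The term \<open>p ^ 4 / 4\<close> cancels in the difference; what remains is at most
  \<open>e * p\<^sup>2\<close>, divided by at least \<open>p ^ 3 / 12\<close>.\<close>

lemma rho_hat_diff_le:
  assumes "copula C" "0 < p" "p \<le> 1"
    and le: "\<And>u v. u \<in> {0..1} \<Longrightarrow> v \<in> {0..1} \<Longrightarrow> \<bar>emp_bernstein_copula m n x y u v - C u v\<bar> \<le> e"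
  shows "\<bar>rho_hat m n x y p - lower_tail_rho C p\<bar> \<le> 12 * e / p"
proof -
  let ?I = "\<lambda>D. LINT w:({0..p} \<times> {0..p})|lborel. D (fst w) (snd w)"
  let ?B = "emp_bernstein_copula m n x y"
  have "e \<ge> 0" using le[of 0 0] by auto
  have D: "rho_denom p \<ge> p ^ 3 / 12" "p ^ 3 / 12 > 0"
    using rho_denom_ge assms by auto
  then have "rho_denom p > 0" by linarith
  have "\<bar>?I ?B - ?I C\<bar> \<le> e * p\<^sup>2"
    using assms
    by (intro set_integral_square_diff_le le continuous_on_subset[OF copula_continuous_on[OF assms(1)]])
       (auto simp: emp_bernstein_copula_def intro: bernstein_op_continuous_on)
  moreover have "rho_hat m n x y p - lower_tail_rho C p = (?I ?B - ?I C) / rho_denom p"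
    by (simp add: rho_hat_def lower_tail_rho_def diff_divide_distrib)
  ultimately have "\<bar>rho_hat m n x y p - lower_tail_rho C p\<bar> \<le> e * p\<^sup>2 / rho_denom p"
    using \<open>rho_denom p > 0\<close> by (simp add: divide_right_mono)
  also have "\<dots> \<le> e * p\<^sup>2 / (p ^ 3 / 12)"
    using D \<open>e \<ge> 0\<close> \<open>rho_denom p > 0\<close> by (intro divide_left_mono) auto
  also have "\<dots> = 12 * e / p"
    using assms by (simp add: field_simps power2_eq_square power3_eq_cube)
  finally show ?thesis .
qed

text \<open>Pathwise form of the result. Allowing \<open>p\<^sub>0 = 1\<close> lets the second claim
  serve every fixed point of (0,1].\<close>

lemma rho_hat_uniform_convergence:
  assumes C: "copula C" and m: "filterlim m at_top sequentially" and p0: "0 < p\<^sub>0" "p\<^sub>0 \<le> 1"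
    and conv: "\<And>e. e > 0 \<Longrightarrow> \<forall>\<^sub>F n in sequentially. \<forall>u\<in>{0..1}. \<forall>v\<in>{0..1}. \<bar>emp_copula n x y u v - C u v\<bar> \<le> e"
  shows "(\<lambda>n. SUP p\<in>{p\<^sub>0..1}. \<bar>rho_hat (m n) n x y p - lower_tail_rho C p\<bar>) \<longlonglongrightarrow> 0"
    and "(\<lambda>n. rho_hat (m n) n x y p\<^sub>0) \<longlonglongrightarrow> lower_tail_rho C p\<^sub>0"
proof -
  have main: "\<forall>\<^sub>F n in sequentially. \<forall>p\<in>{p\<^sub>0..1}. \<bar>rho_hat (m n) n x y p - lower_tail_rho C p\<bar> \<le> e"
    if "e > 0" for e
  proof -
    \<comment> \<open>The empirical copula and the Bernstein averaging contribute at most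
      \<open>d\<close> each, and \<open>12 * (2 * d) / p\<^sub>0 = e\<close>.\<close>
    define d where "d = e * p\<^sub>0 / 24"
    have d: "d > 0" using that p0 by (simp add: d_def)
    have "(\<lambda>k. 2 / sqrt (real k)) \<longlonglongrightarrow> 0"
      by real_asymp
    from filterlim_compose[OF this m] have "(\<lambda>n. 2 / sqrt (m n)) \<longlonglongrightarrow> 0" .
    then have "\<forall>\<^sub>F n in sequentially. 2 / sqrt (m n) < d"
      using d by (rule order_tendstoD)
    moreover have "\<forall>\<^sub>F n in sequentially. m n > 0"
      by (rule eventually_compose_filterlim[OF eventually_gt_at_top m])
    ultimately show ?thesis
      using conv[OF d]
    proof eventually_elim
      case (elim n)
      show ?case
      proof
        fix p assume p: "p \<in> {p\<^sub>0..1}"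
        have "\<bar>emp_bernstein_copula (m n) n x y u v - C u v\<bar> \<le> 2 * d" if "u \<in> {0..1}" "v \<in> {0..1}" for u v
          using bernstein_op_approx[of C "emp_copula n x y" d u v "m n"] elim that copula_lipschitz[OF C]
          by (force simp: emp_bernstein_copula_def)
        then have "\<bar>rho_hat (m n) n x y p - lower_tail_rho C p\<bar> \<le> 12 * (2 * d) / p"
          using p p0 by (intro rho_hat_diff_le C) auto
        also have "\<dots> \<le> 12 * (2 * d) / p\<^sub>0"
          using p p0 d by (intro divide_left_mono) auto
        also have "\<dots> = e"
          using p0 by (simp add: d_def)
        finally show "\<bar>rho_hat (m n) n x y p - lower_tail_rho C p\<bar> \<le> e" .
      qed
    qed
  qed
  show "(\<lambda>n. SUP p\<in>{p\<^sub>0..1}. \<bar>rho_hat (m n) n x y p - lower_tail_rho C p\<bar>) \<longlonglongrightarrow> 0"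
  proof (rule tendstoI)
    fix e :: real assume "e > 0"
    show "\<forall>\<^sub>F n in sequentially. dist (SUP p\<in>{p\<^sub>0..1}. \<bar>rho_hat (m n) n x y p - lower_tail_rho C p\<bar>) 0 < e"
      using main[OF half_gt_zero[OF \<open>e > 0\<close>]]
    proof eventually_elim
      case (elim n)
      let ?f = "\<lambda>p. \<bar>rho_hat (m n) n x y p - lower_tail_rho C p\<bar>"
      have "(SUP p\<in>{p\<^sub>0..1}. ?f p) \<le> e / 2"
        using elim p0 by (intro cSUP_least) auto
      \<comment> \<open>Comparison with the value at \<open>p\<^sub>0\<close> shows that the
        supremum is nonnegative, which removes the absolute value in \<open>dist\<close>.\<close>
      moreover have "?f p\<^sub>0 \<le> (SUP p\<in>{p\<^sub>0..1}. ?f p)"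
        using elim p0 by (intro cSUP_upper bdd_aboveI2[where M = "e / 2"]) auto
      ultimately show ?case
        using \<open>e > 0\<close> by (simp add: dist_real_def)
    qed
  qed
  show "(\<lambda>n. rho_hat (m n) n x y p\<^sub>0) \<longlonglongrightarrow> lower_tail_rho C p\<^sub>0"
  proof (rule tendstoI)
    fix e :: real assume "e > 0"
    show "\<forall>\<^sub>F n in sequentially. dist (rho_hat (m n) n x y p\<^sub>0) (lower_tail_rho C p\<^sub>0) < e"
      using main[OF half_gt_zero[OF \<open>e > 0\<close>]]
    proof eventually_elim
      case (elim n)
      then have "\<bar>rho_hat (m n) n x y p\<^sub>0 - lower_tail_rho C p\<^sub>0\<bar> \<le> e / 2"
        using p0 by simp
      then show ?case
        using \<open>e > 0\<close> by (simp add: dist_real_def)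
    qed
  qed
qed


section \<open>Strong laws for bounded variables and empirical measures\<close>

text \<open>Hoeffding tails decay geometrically in the sample size, so Borel--Cantelli applies for
  each tolerance.\<close>

lemma (in prob_space) strong_law_bounded:
  fixes Z :: "nat \<Rightarrow> 'a \<Rightarrow> real"
  assumes indep: "indep_vars (\<lambda>_. borel) Z {1..}"
    and ident: "\<And>i. i \<ge> 1 \<Longrightarrow> distr M borel (Z i) = distr M borel (Z 1)"
    and bounded: "AE \<omega> in M. Z 1 \<omega> \<in> {a..b}" and "a < b"
  shows "AE \<omega> in M. (\<lambda>n. (\<Sum>i=1..n. Z i \<omega>) / real n) \<longlonglongrightarrow> expectation (Z 1)"
proof -
  have rv [measurable]: "random_variable borel (Z i)" if "i \<ge> 1" for i
    using indep that unfolding indep_vars_def by auto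
  define \<mu> where "\<mu> = expectation (Z 1)"
  have "AE \<omega> in M. \<forall>\<^sub>F n in sequentially. \<bar>(\<Sum>i=1..n. Z i \<omega>) / real n - \<mu>\<bar> < e" if "e > 0" for e
  proof -
    \<comment> \<open>The shift to \<open>Suc n\<close> avoids the empty sample, whose mean is 0 by
      the convention on division by zero.\<close>
    define A where "A n = {\<omega>\<in>space M. \<bar>(\<Sum>i=1..Suc n. Z i \<omega>) / real (Suc n) - \<mu>\<bar> \<ge> e}" for n
    \<comment> \<open>Chosen so that the Hoeffding bound for sample size \<open>n\<close> reads
      \<open>2 * c ^ n\<close>.\<close>
    define c where "c = exp (- 2 * e\<^sup>2 / (b - a)\<^sup>2)"
    have c: "0 < c" "c < 1"
      using that \<open>a < b\<close> by (simp_all add: c_def)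
    have bound: "prob (A n) \<le> 2 * c ^ Suc n" for n
    proof -
      interpret Hoeffding_ineq_iid M "{1..Suc n}" Z "Z 1" a b \<mu>
      proof unfold_locales
        show "indep_vars (\<lambda>_. borel) Z {1..Suc n}"
          by (rule indep_vars_subset[OF indep]) auto
        show "distr M borel (Z i) = distr M borel (Z 1)" if "i \<in> {1..Suc n}" for i
          using that by (intro ident) simp
        show "random_variable borel (Z 1)"
          by (rule rv) simp
        show "AE \<omega> in M. Z 1 \<omega> \<in> {a..b}"
          by (rule bounded)
        show "\<mu> \<equiv> expectation (Z 1)"
          by (simp only: \<mu>_def)
      qed simp
      have "prob (A n) \<le> 2 * exp (- 2 * real (Suc n) * e\<^sup>2 / (b - a)\<^sup>2)"
        using Hoeffding_ineq_abs_ge'[of e] that \<open>a < b\<close> by (simp add: A_def)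
      also have "- 2 * real (Suc n) * e\<^sup>2 / (b - a)\<^sup>2 = real (Suc n) * (- 2 * e\<^sup>2 / (b - a)\<^sup>2)"
        by (simp only: times_divide_eq_right mult_ac)
      also have "exp \<dots> = c ^ Suc n"
        unfolding c_def by (rule exp_of_nat_mult)
      finally show ?thesis .
    qed
    have "AE \<omega> in M. \<forall>\<^sub>F n in sequentially. \<omega> \<in> space M - A n"
    proof (rule borel_cantelli_AE1)
      show "A n \<in> sets M" for n
        unfolding A_def by measurable
      show "emeasure M (A n) < \<infinity>" for n
        using emeasure_finite by (simp only: less_top infinity_ennreal_def not_False_eq_True)
      show "summable (\<lambda>n. prob (A n))"
      proof (rule summable_comparison_test')
        show "summable (\<lambda>n. 2 * c ^ Suc n)"
          using c
          by (intro summable_mult summable_ignore_initial_segment[where k = 1, simplified] summable_geometric) simp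
        show "norm (prob (A n)) \<le> 2 * c ^ Suc n" if "n \<ge> 0" for n
          using bound[of n] by (simp only: real_norm_def abs_of_nonneg[OF measure_nonneg])
      qed
    qed
    then show ?thesis
    proof eventually_elim
      case (elim \<omega>)
      then have "\<forall>\<^sub>F n in sequentially. \<bar>(\<Sum>i=1..Suc n. Z i \<omega>) / real (Suc n) - \<mu>\<bar> < e"
        by (rule eventually_mono) (simp only: A_def Diff_iff mem_Collect_eq de_Morgan_conj not_le, blast)
      then show ?case
        by (simp only: eventually_sequentially_Suc[of "\<lambda>n. \<bar>(\<Sum>i=1..n. Z i \<omega>) / real n - \<mu>\<bar> < e"])
    qed
  qed
  \<comment> \<open>Countably many tolerances keep the union of the exceptional sets null.\<close>
  then have "AE \<omega> in M. \<forall>k. \<forall>\<^sub>F n in sequentially. \<bar>(\<Sum>i=1..n. Z i \<omega>) / real n - \<mu>\<bar> < inverse (real (Suc k))"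
    unfolding AE_all_countable by (intro allI) simp
  then show ?thesis
  proof eventually_elim
    case (elim \<omega>)
    show ?case
    proof (rule tendstoI)
      fix e :: real assume "e > 0"
      then obtain k where "inverse (real (Suc k)) < e"
        using reals_Archimedean by blast
      then show "\<forall>\<^sub>F n in sequentially. dist ((\<Sum>i=1..n. Z i \<omega>) / real n) (expectation (Z 1)) < e"
        using elim[rule_format, of k] by (auto simp: dist_real_def \<mu>_def elim: eventually_mono)
    qed
  qed
qed

text \<open>The indicators of \<open>S\<close> along the sample are independent, identically
  distributed and bounded.\<close>

lemma (in prob_space) emp_measure_strong_law:
  fixes Z :: "nat \<Rightarrow> 'a \<Rightarrow> 'b :: topological_space"
  assumes indep: "indep_vars (\<lambda>_. borel) Z {1..}"
    and ident: "\<And>i. i \<ge> 1 \<Longrightarrow> distr M borel (Z i) = distr M borel (Z 1)"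
    and S [measurable]: "S \<in> sets borel"
  shows "AE \<omega> in M. (\<lambda>n. emp_measure n (\<lambda>i. Z i \<omega>) S) \<longlonglongrightarrow> measure (distr M borel (Z 1)) S"
proof -
  have rv [measurable]: "random_variable borel (Z i)" if "i \<ge> 1" for i
    using indep that unfolding indep_vars_def by auto
  define W where "W i \<omega> = (indicator S (Z i \<omega>) :: real)" for i \<omega>
  have "AE \<omega> in M. (\<lambda>n. (\<Sum>i=1..n. W i \<omega>) / real n) \<longlonglongrightarrow> expectation (W 1)"
  proof (rule strong_law_bounded)
    show "indep_vars (\<lambda>_. borel) W {1..}"
      unfolding W_def by (intro indep_vars_compose2[OF indep]) simp
    show "distr M borel (W i) = distr M borel (W 1)" if "i \<ge> 1" for i
    proof -
      have *: "distr M borel (W j) = distr (distr M borel (Z j)) borel (indicator S)" if "j \<ge> 1" for j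
        unfolding W_def using that by (subst distr_distr) (auto simp: comp_def)
      show ?thesis
        using *[OF that] *[of 1] ident[OF that] by simp
    qed
    show "AE \<omega> in M. W 1 \<omega> \<in> {0..1}"
      by (simp add: W_def indicator_def)
  qed auto
  moreover have "expectation (W 1) = measure (distr M borel (Z 1)) S"
  proof -
    have "expectation (W 1) = expectation (indicator (Z 1 -` S \<inter> space M))"
      by (intro Bochner_Integration.integral_cong) (auto simp: W_def indicator_def)
    also have "\<dots> = measure (distr M borel (Z 1)) S"
      by (simp add: measure_distr)
    finally show ?thesis .
  qed
  ultimately show ?thesis
    by (simp add: W_def emp_measure_def)
qed

section \<open>Marginal quantiles and almost sure convergence\<close>

text \<open>The limits 0 and 1 at the two infinities provide values below and above \<open>q\<close>
  for the intermediate value theorem.\<close>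

lemma (in real_distribution) continuous_cdf_quantile:
  assumes "continuous_on UNIV (cdf M)" "0 < q" "q < 1"
  shows "\<exists>x. cdf M x = q"
proof -
  have "\<forall>\<^sub>F x in at_bot. cdf M x < q"
    using cdf_lim_at_bot \<open>0 < q\<close> by (rule order_tendstoD)
  then obtain s where s: "cdf M s < q"
    using eventually_happens by force
  have "\<forall>\<^sub>F x in at_top. cdf M x > q"
    using cdf_lim_at_top_prob \<open>q < 1\<close> by (rule order_tendstoD)
  then obtain t where t: "cdf M t > q"
    using eventually_happens by force
  have "s \<le> t"
    using s t cdf_nondecreasing[of t s] by linarith
  then show ?thesis
    using IVT'[of "cdf M" s q t] s t continuous_on_subset[OF assms(1), of "{s..t}"] by auto
qed

theorem theorem2p1:
  fixes M :: "'a measure"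
    and X Y :: "nat \<Rightarrow> 'a \<Rightarrow> real"
    and H C :: "real \<Rightarrow> real \<Rightarrow> real"
    and F G :: "real \<Rightarrow> real"
    and p\<^sub>0 :: real
    and m :: "nat \<Rightarrow> nat"
  assumes "prob_space M"
    and indep: "prob_space.indep_vars M (\<lambda>_. borel) (\<lambda>i \<omega>. (X i \<omega>, Y i \<omega>)) {1..}"
    and ident: "\<forall>i\<ge>1. distr M borel (\<lambda>\<omega>. (X i \<omega>, Y i \<omega>)) = distr M borel (\<lambda>\<omega>. (X 1 \<omega>, Y 1 \<omega>))"
    and H: "H = joint_cdf (distr M borel (\<lambda>\<omega>. (X 1 \<omega>, Y 1 \<omega>)))"
    and F: "F = cdf (distr M borel (X 1))"
    and G: "G = cdf (distr M borel (Y 1))"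
    and "continuous_on UNIV F"
    and "continuous_on UNIV G"
    and "copula C"
    and sklar: "\<forall>x y. H x y = C (F x) (G y)"
    and "0 < p\<^sub>0" "p\<^sub>0 < 1"
    and "\<forall>n\<ge>1. m n \<ge> 1"
    and "filterlim m at_top sequentially"
  shows "(AE \<omega> in M.
           (\<lambda>n. SUP p\<in>{p\<^sub>0..1}.
              \<bar>rho_hat (m n) n (\<lambda>i. X i \<omega>) (\<lambda>i. Y i \<omega>) p - lower_tail_rho C p\<bar>) \<longlonglongrightarrow> 0) \<and>
         (\<forall>p\<in>{0<..1}. AE \<omega> in M.
           (\<lambda>n. rho_hat (m n) n (\<lambda>i. X i \<omega>) (\<lambda>i. Y i \<omega>) p) \<longlonglongrightarrow> lower_tail_rho C p)"
proof -
  interpret prob_space M by fact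
  let ?Z = "\<lambda>i \<omega>. (X i \<omega>, Y i \<omega>)"
  let ?D = "distr M borel (?Z 1)"
  have "\<forall>i\<in>{1..}. ?Z i \<in> borel_measurable M"
    using indep unfolding indep_vars_def by blast
  then have Z: "?Z 1 \<in> borel_measurable M"
    by (rule bspec) simp
  have X: "X 1 \<in> borel_measurable M"
    using measurable_compose[OF Z borel_measurable_continuous_onI[OF continuous_on_fst[OF continuous_on_id]]] by simp
  have Y: "Y 1 \<in> borel_measurable M"
    using measurable_compose[OF Z borel_measurable_continuous_onI[OF continuous_on_snd[OF continuous_on_id]]] by simp
  interpret D: prob_space ?D by (rule prob_space_distr[OF Z])
  interpret DX: real_distribution "distr M borel (X 1)"
    by (intro real_distribution_distr X)
  interpret DY: real_distribution "distr M borel (Y 1)"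
    by (intro real_distribution_distr Y)
  obtain a where a: "\<And>q. 0 < q \<Longrightarrow> q < 1 \<Longrightarrow> F (a q) = q"
    using DX.continuous_cdf_quantile \<open>continuous_on UNIV F\<close> unfolding F by metis
  obtain b where b: "\<And>q. 0 < q \<Longrightarrow> q < 1 \<Longrightarrow> G (b q) = q"
    using DY.continuous_cdf_quantile \<open>continuous_on UNIV G\<close> unfolding G by metis
  \<comment> \<open>Sklar's formula speaks of finite corners only, so half-planes are measured
    through the marginal law.\<close>
  have margX: "measure ?D ({..t} \<times> UNIV) = F t" for t
  proof -
    have "?Z 1 -` ({..t} \<times> UNIV) \<inter> space M = X 1 -` {..t} \<inter> space M" by auto
    moreover have "({..t} \<times> UNIV :: (real \<times> real) set) \<in> sets borel"
      by (intro borel_closed closed_Times) auto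
    ultimately show ?thesis
      by (simp add: F cdf_def measure_distr X Y Z del: One_nat_def)
  qed
  have margY: "measure ?D (UNIV \<times> {..t}) = G t" for t
  proof -
    have "?Z 1 -` (UNIV \<times> {..t}) \<inter> space M = Y 1 -` {..t} \<inter> space M" by auto
    moreover have "(UNIV \<times> {..t} :: (real \<times> real) set) \<in> sets borel"
      by (intro borel_closed closed_Times) auto
    ultimately show ?thesis
      by (simp add: G cdf_def measure_distr X Y Z del: One_nat_def)
  qed
  have joint: "measure ?D ({..s} \<times> {..t}) = C (F s) (G t)" for s t
    using sklar unfolding H joint_cdf_def by simp
  have C0: "C u 0 = 0" "C 0 u = 0" "C u 1 = u" "C 1 u = u" if "u \<in> {0..1}" for u
    using \<open>copula C\<close> that unfolding copula_def by auto
  have whole: "measure ?D UNIV = 1"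
    using D.prob_space by (simp del: One_nat_def)
  \<comment> \<open>An empty side gives 0 and a full side a marginal, as in the boundary values of
    \<open>C\<close>; interior levels use Sklar's formula at the quantiles.\<close>
  have meas: "measure ?D (level a q \<times> level b r) = C (clamp01 q) (clamp01 r)" for q r
  proof -
    have cl: "clamp01 q \<in> {0..1}" "clamp01 r \<in> {0..1}" by (auto simp: clamp01_def)
    consider "q \<le> 0" | "r \<le> 0" | "q \<ge> 1" "r \<ge> 1" | "q \<ge> 1" "0 < r" "r < 1"
      | "0 < q" "q < 1" "r \<ge> 1" | "0 < q" "q < 1" "0 < r" "r < 1" by linarith
    then show ?thesis
    proof cases
      case 1
      then have "level a q = {}" "clamp01 q = 0" by (auto simp: level_def clamp01_def)
      then show ?thesis using C0(2)[OF cl(2)] by simp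
    next
      case 2
      then have "level b r = {}" "clamp01 r = 0" by (auto simp: level_def clamp01_def)
      then show ?thesis using C0(1)[OF cl(1)] by simp
    next
      case 3
      then show ?thesis using C0(3)[of 1] whole by (simp add: level_def clamp01_def)
    next
      case 4
      then show ?thesis using C0(4)[of r] margY[of "b r"] b[of r] by (simp add: level_def clamp01_def)
    next
      case 5
      then show ?thesis using C0(3)[of q] margX[of "a q"] a[of q] by (simp add: level_def clamp01_def)
    next
      case 6
      then show ?thesis using joint[of "a q" "b r"] a[of q] b[of r] by (simp add: level_def clamp01_def)
    qed
  qed
  have level_closed: "closed (level c q)" for c q
    by (simp add: level_def)
  have "AE \<omega> in M.
      (\<lambda>n. emp_measure n (\<lambda>i. ?Z i \<omega>) (level a q \<times> level b r)) \<longlonglongrightarrow> C (clamp01 q) (clamp01 r)" for q r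
    unfolding meas[symmetric]
  proof (rule emp_measure_strong_law[OF indep])
    show "distr M borel (?Z i) = distr M borel (?Z 1)" if "i \<ge> 1" for i
      using ident that by blast
    show "level a q \<times> level b r \<in> sets borel"
      by (intro borel_closed closed_Times level_closed)
  qed
  \<comment> \<open>Rational levels are countable, so one null set serves them all.\<close>
  then have "AE \<omega> in M. \<forall>q\<in>\<rat>. \<forall>r\<in>\<rat>.
      (\<lambda>n. emp_measure n (\<lambda>i. ?Z i \<omega>) (level a q \<times> level b r)) \<longlonglongrightarrow> C (clamp01 q) (clamp01 r)"
    by (simp add: AE_ball_countable countable_rat)
  then have ae: "AE \<omega> in M. \<forall>e>0. \<forall>\<^sub>F n in sequentially. \<forall>u\<in>{0..1}. \<forall>v\<in>{0..1}.
      \<bar>emp_copula n (\<lambda>i. X i \<omega>) (\<lambda>i. Y i \<omega>) u v - C u v\<bar> \<le> e"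
    by eventually_elim (auto intro!: emp_copula_uniform_convergence[OF \<open>copula C\<close>])
  show ?thesis
  proof (intro conjI ballI)
    show "AE \<omega> in M. (\<lambda>n. SUP p\<in>{p\<^sub>0..1}.
        \<bar>rho_hat (m n) n (\<lambda>i. X i \<omega>) (\<lambda>i. Y i \<omega>) p - lower_tail_rho C p\<bar>) \<longlonglongrightarrow> 0"
      using ae
      by eventually_elim (intro rho_hat_uniform_convergence(1) \<open>copula C\<close> \<open>filterlim m at_top sequentially\<close>
        \<open>0 < p\<^sub>0\<close> less_imp_le[OF \<open>p\<^sub>0 < 1\<close>], blast)
    \<comment> \<open>The pathwise result is applied with \<open>p\<close> itself as the left end
      point.\<close>
    show "AE \<omega> in M. (\<lambda>n. rho_hat (m n) n (\<lambda>i. X i \<omega>) (\<lambda>i. Y i \<omega>) p) \<longlonglongrightarrow> lower_tail_rho C p"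
      if "p \<in> {0<..1}" for p
      using ae
      by eventually_elim (use that in \<open>intro rho_hat_uniform_convergence(2) \<open>copula C\<close>
        \<open>filterlim m at_top sequentially\<close>; force\<close>)
  qed
qed

end
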